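(* Let $|q|<1$ and $\max\{|a|,|b|,|c|,|u|,|v|\}<1$, and let $f(x)$ be a function such that $\lim_{n\to\infty}|f(xq^n)/f(xq^{n-1})|\le1$. Then \[ \frac{(q;q)_\infty}{2\pi}\int_0^\pi\frac{h(\cos2\theta;1)}{h(\cos\theta;a,b,c)}\left\{\int_u^v\frac{(qx/u,qx/v;q)_\infty f(x)}{(xe^{i\theta},xe^{-i\theta};q)_\infty}\,d_qx\right\}d\theta =\frac{1}{(ab,ac,bc;q)_\infty}\int_u^v\frac{(qx/u,qx/v,abcx;q)_\infty f(x)}{(ax,bx,cx;q)_\infty}\,d_qx. \]
   Context: $(a;q)_\infty=\prod_{k\ge0}(1-aq^k)$, $(a_1,\ldots,a_m;q)_\infty=(a_1;q)_\infty\cdots(a_m;q)_\infty$. The Jackson $q$-integral is $\int_a^b g(x)\,d_qx=(1-q)\sum_{n=0}^\infty[bg(bq^n)-ag(aq^n)]q^n$. For $x=\cos\theta$, $h(x;a)=(ae^{i\theta},ae^{-i\theta};q)_\infty=\prod_{k\ge0}(1-2q^kax+q^{2k}a^2)$ and $h(x;a_1,\ldots,a_m)=h(x;a_1)\cdots h(x;a_m)$. *)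

theory Defs
  imports "HOL-Analysis.Analysis"
begin

definition qpoch_inf :: "complex \<Rightarrow> complex \<Rightarrow> complex" where
  "qpoch_inf q a = (\<Prod>k. 1 - a * q ^ k)"

text \<open>The multi-parameter symbol \<open>(a\<^sub>1, \<dots>, a\<^sub>m; q)\<^sub>\<infinity>\<close>.\<close>

definition qpochs_inf :: "complex \<Rightarrow> complex list \<Rightarrow> complex" where
  "qpochs_inf q as = (\<Prod>a\<leftarrow>as. qpoch_inf q a)"

text \<open>For \<open>x = cos \<theta>\<close> the \<open>k\<close>-th factor of \<open>h(x; a)\<close> equals
  \<open>(1 - a e\<^sup>i\<^sup>\<theta> q\<^sup>k) (1 - a e\<^sup>-\<^sup>i\<^sup>\<theta> q\<^sup>k)\<close>.\<close>

definition h_fun :: "complex \<Rightarrow> complex \<Rightarrow> complex \<Rightarrow> complex" where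
  "h_fun q x a = (\<Prod>k. 1 - 2 * q ^ k * a * x + q ^ (2 * k) * a\<^sup>2)"

definition hs_fun :: "complex \<Rightarrow> complex \<Rightarrow> complex list \<Rightarrow> complex" where
  "hs_fun q x as = (\<Prod>a\<leftarrow>as. h_fun q x a)"

text \<open>The Jackson integral \<open>\<integral>\<^sub>a\<^sup>b g(x) d\<^sub>qx\<close>, with complex base and endpoints.\<close>

definition jackson_integral ::
    "complex \<Rightarrow> complex \<Rightarrow> complex \<Rightarrow> (complex \<Rightarrow> complex) \<Rightarrow> complex" where
  "jackson_integral q a b g =
     (1 - q) * (\<Sum>n. (b * g (b * q ^ n) - a * g (a * q ^ n)) * q ^ n)"

text \<open>The condition \<open>lim |f(x q\<^sup>n) / f(x q\<^sup>n\<^sup>-\<^sup>1)| \<le> 1\<close> along the orbit of \<open>x\<close>.  Since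
  division by zero yields zero in HOL, the requirement that the quotients be defined for all
  large \<open>n\<close>, implicit in the existence of the limit, is made explicit.\<close>

definition q_ratio_limit_le_1 :: "complex \<Rightarrow> (complex \<Rightarrow> complex) \<Rightarrow> complex \<Rightarrow> bool" where
  "q_ratio_limit_le_1 q f x \<longleftrightarrow>
     (\<forall>\<^sub>F n in sequentially. f (x * q ^ n) \<noteq> 0) \<and>
     (\<exists>L\<le>1. (\<lambda>n. cmod (f (x * q ^ Suc n) / f (x * q ^ n))) \<longlonglongrightarrow> L)"

end

theory Submission
  imports Defs "HOL-Complex_Analysis.Complex_Analysis"
begin

text \<open>
  Since \<open>1 / (x e\<^sup>i\<^sup>\<theta>, x e\<^sup>-\<^sup>i\<^sup>\<theta>; q)\<^sub>\<infinity> = 1 / h(cos \<theta>; x)\<close>, interchanging the integral with the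
  absolutely convergent Jackson sums reduces the claim, term by term, to the Askey--Wilson integral
  \<open>I(a, b, c, d)\<close> with \<open>d = u q\<^sup>n\<close> or \<open>d = v q\<^sup>n\<close>.

  To evaluate \<open>I\<close>, consider
  \<open>G(z) = z\<^sup>3 (q z\<^sup>2, z\<^sup>-\<^sup>2; q)\<^sub>\<infinity> / \<Prod> (t z, q t / z; q)\<^sub>\<infinity>\<close>, the product being over \<open>t = a, b, c, d\<close>.
  It satisfies \<open>G(1 / z) = - G(q z)\<close> and has no singularities between the circles
  \<open>|z| = 1\<close> and \<open>|z| = |q|\<close>, so its mean over the unit circle vanishes. On the unit circle
  \<open>G(z) + G(1 / z)\<close> is the weight times an affine function of \<open>cos \<theta>\<close>, and this gives
  \<open>(1 - abcd) I(aq, b, c, d) = (1 - ab) (1 - ac) (1 - ad) I(a, b, c, d)\<close>. Iterating in each of the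
  parameters determines \<open>I\<close> up to the constant \<open>I(0, 0, 0, 0)\<close>, which is found from
  \<open>a = q\<close>, \<open>b = -q\<close>, \<open>c = \<surd>q\<close>, \<open>d = -\<surd>q\<close>.
\<close>

subsection \<open>The infinite \<open>q\<close>-Pochhammer symbol\<close>

lemma convergent_prod_qpoch:
  fixes q a :: complex
  assumes "cmod q < 1"
  shows "convergent_prod (\<lambda>k. 1 - a * q ^ k)"
proof -
  have "summable (\<lambda>k. norm (- (a * q ^ k)))"
    using assms by (simp add: norm_mult norm_power)
  then have "abs_convergent_prod (\<lambda>k. 1 - a * q ^ k)"
    by (simp add: abs_convergent_prod_conv_summable)
  then show ?thesis
    by (rule abs_convergent_prod_imp_convergent_prod)
qed

lemma qpoch_inf_LIMSEQ:
  assumes "cmod q < 1"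
  shows "(\<lambda>n. \<Prod>k<n. 1 - a * q ^ k) \<longlonglongrightarrow> qpoch_inf q a"
  using convergent_prod_LIMSEQ[OF convergent_prod_qpoch[OF assms, of a]]
  unfolding qpoch_inf_def by (simp add: LIMSEQ_lessThan_iff_atMost)

lemma qpoch_inf_rec:
  assumes "cmod q < 1"
  shows "qpoch_inf q a = (1 - a) * qpoch_inf q (a * q)"
proof -
  have "(\<lambda>n. \<Prod>k<Suc n. 1 - a * q ^ k) \<longlonglongrightarrow> qpoch_inf q a"
    using qpoch_inf_LIMSEQ[OF assms] by (rule LIMSEQ_Suc)
  moreover have "(\<Prod>k<Suc n. 1 - a * q ^ k) = (1 - a) * (\<Prod>k<n. 1 - a * q * q ^ k)" for n
    by (subst prod.lessThan_Suc_shift) (simp add: mult_ac)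
  ultimately have "(\<lambda>n. (1 - a) * (\<Prod>k<n. 1 - a * q * q ^ k)) \<longlonglongrightarrow> qpoch_inf q a"
    by simp
  moreover have "(\<lambda>n. (1 - a) * (\<Prod>k<n. 1 - a * q * q ^ k)) \<longlonglongrightarrow> (1 - a) * qpoch_inf q (a * q)"
    by (intro tendsto_intros qpoch_inf_LIMSEQ assms)
  ultimately show ?thesis
    by (rule LIMSEQ_unique)
qed

lemma qpoch_inf_nonzero:
  assumes "cmod q < 1" "cmod a < 1"
  shows "qpoch_inf q a \<noteq> 0"
  unfolding qpoch_inf_def
proof (rule prodinf_nonzero[OF convergent_prod_qpoch[OF assms(1)]])
  fix k
  have "cmod (a * q ^ k) \<le> cmod a * 1"
    unfolding norm_mult norm_power using assms by (intro mult_left_mono power_le_one) auto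
  then show "1 - a * q ^ k \<noteq> 0"
    using assms(2) by auto
qed

lemma qpoch_inf_zero_right [simp]: "qpoch_inf q 0 = 1"
  by (simp add: qpoch_inf_def)

text \<open>Since 0^0 = 1, only the factor k = 0 differs from 1. This makes the base q = 0 explicit,
  where the annulus argument below degenerates.\<close>

lemma qpoch_inf_zero_left: "qpoch_inf 0 a = 1 - a"
  by (subst qpoch_inf_rec) auto

section \<open>Analyticity and local boundedness of the q-Pochhammer symbol\<close>

lemma holomorphic_qpoch_inf:
  assumes "cmod q < 1"
  shows "qpoch_inf q holomorphic_on A"
proof (rule holomorphic_on_subset)
  show "qpoch_inf q holomorphic_on UNIV"
  proof (rule holomorphic_uniform_sequence)
    fix z :: complex
    have "uniformly_convergent_on (cball z 1) (\<lambda>N x. \<Prod>n<N. 1 - x * q ^ n)"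
    proof (rule uniformly_convergent_on_prod')
      \<comment> \<open>The n-th factor differs from 1 by \<open>x * q ^ n\<close>, which on the
        unit disc about \<open>z\<close> has the geometric majorant
        \<open>(cmod z + 1) * cmod q ^ n\<close>.\<close>
      have "uniformly_convergent_on (cball z 1) (\<lambda>N x. \<Sum>n<N. cmod (1 - x * q ^ n - 1))"
      proof (rule Weierstrass_m_test')
        fix n x assume "x \<in> cball z 1"
        then have "cmod x \<le> cmod z + 1"
          using norm_triangle_ineq2[of x z] by (simp add: dist_norm norm_minus_commute)
        then show "norm (cmod (1 - x * q ^ n - 1)) \<le> (cmod z + 1) * cmod q ^ n"
          by (simp add: norm_mult norm_power mult_right_mono)
      qed (use assms in simp)
      then show "uniformly_convergent_on (cball z 1) (\<lambda>N x. \<Sum>n<N. norm (1 - x * q ^ n - 1))" .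
    qed (auto intro!: continuous_intros)
    then obtain g where g: "uniform_limit (cball z 1) (\<lambda>N x. \<Prod>n<N. 1 - x * q ^ n) g sequentially"
      by (auto simp: uniformly_convergent_on_def)
    also have "?this \<longleftrightarrow> uniform_limit (cball z 1) (\<lambda>N x. \<Prod>n<N. 1 - x * q ^ n) (qpoch_inf q) sequentially"
      using LIMSEQ_unique[OF tendsto_uniform_limitI[OF g] qpoch_inf_LIMSEQ[OF assms]]
      by (intro uniform_limit_cong) auto
    finally show "\<exists>d>0. cball z d \<subseteq> UNIV \<and>
        uniform_limit (cball z d) (\<lambda>N x. \<Prod>n<N. 1 - x * q ^ n) (qpoch_inf q) sequentially"
      by (intro exI[of _ 1]) auto
  qed (auto intro!: holomorphic_intros)
qed auto

lemma holomorphic_on_qpoch_inf [holomorphic_intros]: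
  assumes "cmod q < 1" "g holomorphic_on A"
  shows "(\<lambda>z. qpoch_inf q (g z)) holomorphic_on A"
  using holomorphic_on_compose[OF assms(2) holomorphic_qpoch_inf[OF assms(1)]] by (simp add: o_def)

lemma continuous_on_qpoch_inf [continuous_intros]:
  assumes "cmod q < 1" "continuous_on A g"
  shows "continuous_on A (\<lambda>z. qpoch_inf q (g z))"
  using continuous_on_compose[OF assms(2)
      holomorphic_on_imp_continuous_on[OF holomorphic_qpoch_inf[OF assms(1)]]]
  by (simp add: o_def)

lemma qpoch_inf_bounded:
  assumes "cmod q < 1"
  obtains B where "\<And>z. cmod z \<le> R \<Longrightarrow> cmod (qpoch_inf q z) \<le> B"
proof -
  have "compact (qpoch_inf q ` cball 0 R)"
    by (intro compact_continuous_image holomorphic_on_imp_continuous_on holomorphic_qpoch_inf assms)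
      auto
  then show ?thesis
    using that by (force dest: compact_imp_bounded simp: bounded_iff)
qed

section \<open>Product identities between the bases \<open>q\<close> and \<open>q^2\<close>\<close>

lemma qpoch_inf_mult_uminus:
  assumes "cmod q < 1"
  shows "qpoch_inf q a * qpoch_inf q (- a) = qpoch_inf (q\<^sup>2) (a\<^sup>2)"
proof -
  have "(1 - a * q ^ k) * (1 - (- a) * q ^ k) = 1 - a\<^sup>2 * (q\<^sup>2) ^ k" for k
    by (simp add: algebra_simps power2_eq_square power_mult_distrib)
  then show ?thesis
    unfolding qpoch_inf_def
    by (simp only: prodinf_mult[OF convergent_prod_qpoch[OF assms] convergent_prod_qpoch[OF assms]])
qed

lemma qpoch_inf_even_odd:
  assumes "cmod q < 1"
  shows "qpoch_inf (q\<^sup>2) a * qpoch_inf (q\<^sup>2) (a * q) = qpoch_inf q a"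
proof -
  have q2: "cmod (q\<^sup>2) < 1"
    using assms by (simp add: norm_power power_less_one_iff)
  have "(\<Prod>k<2*n. 1 - a * q ^ k) = (\<Prod>k<n. 1 - a * (q\<^sup>2) ^ k) * (\<Prod>k<n. 1 - a * q * (q\<^sup>2) ^ k)" for n
    by (induction n) (simp_all add: mult.assoc mult.left_commute flip: power_mult)
  moreover have "(\<lambda>n. \<Prod>k<2*n. 1 - a * q ^ k) \<longlonglongrightarrow> qpoch_inf q a"
    using qpoch_inf_LIMSEQ[OF assms, of a]
    by (rule filterlim_compose) (simp add: filterlim_subseq strict_mono_def)
  ultimately have "(\<lambda>n. (\<Prod>k<n. 1 - a * (q\<^sup>2) ^ k) * (\<Prod>k<n. 1 - a * q * (q\<^sup>2) ^ k)) \<longlonglongrightarrow> qpoch_inf q a"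
    by simp
  then show ?thesis
    using tendsto_mult[OF qpoch_inf_LIMSEQ[OF q2, of a] qpoch_inf_LIMSEQ[OF q2, of "a * q"]]
      LIMSEQ_unique by blast
qed

text \<open>Euler's identity behind partitions into odd and into distinct parts. After
  multiplication by \<open>qpoch_inf q q\<close>, difference of squares produces the symbol of
  \<open>q^2\<close> in base \<open>q^2\<close>; even and odd factors then recombine to
  \<open>qpoch_inf q q\<close>, which cancels.\<close>

lemma qpoch_inf_euler:
  assumes "cmod q < 1"
  shows "qpoch_inf (q\<^sup>2) q * qpoch_inf q (- q) = 1"
proof -
  have "qpoch_inf q q * (qpoch_inf (q\<^sup>2) q * qpoch_inf q (- q))
      = qpoch_inf (q\<^sup>2) q * (qpoch_inf q q * qpoch_inf q (- q))"
    by (simp only: mult_ac)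
  also have "\<dots> = qpoch_inf (q\<^sup>2) q * qpoch_inf (q\<^sup>2) (q * q)"
    by (simp only: qpoch_inf_mult_uminus[OF assms] power2_eq_square[of q])
  also have "\<dots> = qpoch_inf q q"
    by (rule qpoch_inf_even_odd[OF assms])
  finally have "qpoch_inf q q * (qpoch_inf (q\<^sup>2) q * qpoch_inf q (- q)) = qpoch_inf q q" .
  then show ?thesis
    using qpoch_inf_nonzero[OF assms assms] by simp
qed

lemma h_fun_eq:
  assumes "cmod q < 1" "z \<noteq> 0"
  shows "h_fun q ((z + 1 / z) / 2) a = qpoch_inf q (a * z) * qpoch_inf q (a / z)"
proof -
  have "(1 - a * z * q ^ k) * (1 - a / z * q ^ k) = 1 - 2 * q ^ k * a * ((z + 1 / z) / 2) + q ^ (2 * k) * a\<^sup>2" for k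
  proof -
    have "(1 - a * z * q ^ k) * (1 - a / z * q ^ k) = 1 - a * q ^ k * (z + 1 / z) + (a * q ^ k)\<^sup>2 * (z * (1 / z))"
      by (simp add: algebra_simps power2_eq_square)
    then show ?thesis
      using assms(2) by (simp add: power_mult_distrib mult_ac flip: power_mult)
  qed
  then show ?thesis
    unfolding h_fun_def qpoch_inf_def
    by (simp only: prodinf_mult[OF convergent_prod_qpoch[OF assms(1)] convergent_prod_qpoch[OF assms(1)]])
qed

lemma h_fun_cos:
  assumes "cmod q < 1"
  shows "h_fun q (complex_of_real (cos \<theta>)) a = qpoch_inf q (a * cis \<theta>) * qpoch_inf q (a / cis \<theta>)"
proof -
  have "(cis \<theta> + 1 / cis \<theta>) / 2 = complex_of_real (cos \<theta>)"
    by (simp add: complex_eq_iff flip: cis_inverse inverse_eq_divide)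
  then show ?thesis
    using h_fun_eq[OF assms, of "cis \<theta>" a] by simp
qed

subsection \<open>Shifting contours of periodic functions\<close>

text \<open>Contour integrals over circles are written as integrals of \<open>2\<pi>\<i>\<close>-periodic functions along
  vertical segments, so that Cauchy's theorem on an annulus reduces to the existence of primitives
  on a convex strip.\<close>

lemma has_integral_vertical_segment:
  assumes "\<And>\<theta>. \<theta> \<in> {-pi..pi} \<Longrightarrow>
      (g has_field_derivative H (p + \<i> * complex_of_real \<theta>)) (at (p + \<i> * complex_of_real \<theta>))"
  shows "((\<lambda>\<theta>. H (p + \<i> * complex_of_real \<theta>)) has_integral
      (g (p + \<i> * complex_of_real pi) - g (p - \<i> * complex_of_real pi)) / \<i>) {-pi..pi}"
proof -
  have "((\<lambda>\<theta>. g (p + \<i> * complex_of_real \<theta>) / \<i>) has_vector_derivative H (p + \<i> * complex_of_real \<theta>))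
      (at \<theta> within {-pi..pi})" if "\<theta> \<in> {-pi..pi}" for \<theta>
  proof -
    have "((\<lambda>\<theta>. p + \<i> * complex_of_real \<theta>) has_vector_derivative \<i>) (at \<theta> within {-pi..pi})"
      by (auto intro!: derivative_eq_intros)
    from field_vector_diff_chain_within[OF this DERIV_subset[OF assms[OF that]]]
    have "(g \<circ> (\<lambda>\<theta>. p + \<i> * complex_of_real \<theta>) has_vector_derivative \<i> * H (p + \<i> * complex_of_real \<theta>))
        (at \<theta> within {-pi..pi})"
      by simp
    from has_vector_derivative_divide[OF this, of \<i>] show ?thesis
      by (simp add: o_def)
  qed
  from fundamental_theorem_of_calculus[OF _ this] show ?thesis
    by (simp add: right_diff_distrib)
qed

lemma integral_vertical_segment_eq:
  assumes "H holomorphic_on {s. l < Re s \<and> Re s < u}"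
    and "\<And>s. H (s + 2 * complex_of_real pi * \<i>) = H s"
    and "l < Re p" "Re p < u" "l < Re p'" "Re p' < u"
  shows "integral {-pi..pi} (\<lambda>\<theta>. H (p + \<i> * complex_of_real \<theta>)) =
    integral {-pi..pi} (\<lambda>\<theta>. H (p' + \<i> * complex_of_real \<theta>))"
proof -
  define S where "S = {s. l < Re s \<and> Re s < u}"
  have S: "S = {s. l < Re s} \<inter> {s. Re s < u}"
    by (auto simp: S_def)
  have convex: "convex S" and opn: "open S"
    unfolding S by (intro convex_Int open_Int convex_halfspace_Re_gt convex_halfspace_Re_lt
        open_halfspace_Re_gt open_halfspace_Re_lt)+
  obtain g where "\<And>s. s \<in> S \<Longrightarrow> (g has_field_derivative H s) (at s within S)"
    using holomorphic_convex_primitive'[OF convex opn] assms(1) by (auto simp: S_def)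
  then have g: "(g has_field_derivative H s) (at s)" if "s \<in> S" for s
    using that opn by (metis at_within_open)
  have pm: "s + \<i> * complex_of_real \<theta> \<in> S" if "s \<in> S" for s \<theta>
    using that by (simp add: S_def)
  \<comment> \<open>The increment of the primitive over one period has derivative zero because
    \<open>H\<close> is periodic, so it is the same at every point of the convex strip. Up to the
    factor 1/i it is the integral along the segment.\<close>
  have "\<exists>c. \<forall>s\<in>S. g (s + \<i> * complex_of_real pi) - g (s + \<i> * complex_of_real (-pi)) = c"
  proof (rule has_field_derivative_zero_constant[OF convex])
    fix s assume s: "s \<in> S"
    have "((\<lambda>s. g (s + \<i> * complex_of_real \<theta>)) has_field_derivative H (s + \<i> * complex_of_real \<theta>)) (at s)" for \<theta>
      using g[OF pm[OF s]] by (simp add: DERIV_shift)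
    note DERIV_diff[OF this[of pi] this[of "-pi"]]
    moreover have "H (s + \<i> * complex_of_real pi) = H (s + \<i> * complex_of_real (-pi))"
      using assms(2)[of "s + \<i> * complex_of_real (-pi)"] by (simp add: algebra_simps)
    ultimately show "((\<lambda>s. g (s + \<i> * complex_of_real pi) - g (s + \<i> * complex_of_real (-pi)))
        has_field_derivative 0) (at s within S)"
      by (simp add: has_field_derivative_at_within)
  qed
  moreover have "p \<in> S" "p' \<in> S"
    using assms by (auto simp: S_def)
  ultimately show ?thesis
    using has_integral_vertical_segment[of g H p, OF g[OF pm]]
      has_integral_vertical_segment[of g H p', OF g[OF pm]]
    by (fastforce dest!: integral_unique)
qed

subsection \<open>The Askey--Wilson weight\<close>

text \<open>By \<open>h_fun_eq\<close> this is h((z + 1/z)/2; a). The variable z separates the two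
  Pochhammer symbols, since \<open>aw_cert\<close> shifts only one of each such pair.\<close>

definition aw_factor :: "complex \<Rightarrow> complex \<Rightarrow> complex \<Rightarrow> complex" where
  "aw_factor q z a = qpoch_inf q (a * z) * qpoch_inf q (a / z)"

text \<open>At z = cis theta the numerator is h(cos 2 theta; 1), so this is the Askey-Wilson weight
  with respect to d theta.\<close>

definition aw_weight :: "complex \<Rightarrow> complex \<Rightarrow> complex \<Rightarrow> complex \<Rightarrow> complex \<Rightarrow> complex \<Rightarrow> complex" where
  "aw_weight q a b c d z = aw_factor q (z\<^sup>2) 1 /
     (aw_factor q z a * aw_factor q z b * aw_factor q z c * aw_factor q z d)"

definition aw_integral :: "complex \<Rightarrow> complex \<Rightarrow> complex \<Rightarrow> complex \<Rightarrow> complex \<Rightarrow> complex" where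
  "aw_integral q a b c d = integral {0..pi} (\<lambda>\<theta>. aw_weight q a b c d (cis \<theta>))"

lemma aw_factor_nonzero:
  assumes "cmod q < 1" "cmod a < 1" "cmod z = 1"
  shows "aw_factor q z a \<noteq> 0"
  using assms by (simp add: aw_factor_def norm_mult norm_divide qpoch_inf_nonzero)

lemma aw_factor_rec:
  assumes "cmod q < 1"
  shows "aw_factor q z a = (1 - a * z) * (1 - a / z) * aw_factor q z (a * q)"
  using qpoch_inf_rec[OF assms, of "a * z"] qpoch_inf_rec[OF assms, of "a / z"]
  by (simp add: aw_factor_def mult_ac)

text \<open>The quotient of this function by \<open>aw_weight q a b c d z\<close> is
  \<open>(z - a) (z - b) (z - c) (z - d) / (z (1 - z\<^sup>2))\<close>; the exponent of \<open>z\<close> is what makes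
  \<open>aw_cert_inverse\<close> hold.\<close>

definition aw_cert :: "complex \<Rightarrow> complex \<Rightarrow> complex \<Rightarrow> complex \<Rightarrow> complex \<Rightarrow> complex \<Rightarrow> complex" where
  "aw_cert q a b c d z = z ^ 3 * qpoch_inf q (q * z\<^sup>2) * qpoch_inf q (1 / z\<^sup>2) /
     ((qpoch_inf q (a * z) * qpoch_inf q (a * q / z)) * (qpoch_inf q (b * z) * qpoch_inf q (b * q / z)) *
      (qpoch_inf q (c * z) * qpoch_inf q (c * q / z)) * (qpoch_inf q (d * z) * qpoch_inf q (d * q / z)))"

text \<open>Both arguments give the same denominator, as each parameter t contributes the symbols of
  t/z and tqz. The numerators share infinite tails and differ by three elementary factors
  each.\<close>

lemma aw_cert_inverse:
  assumes "cmod q < 1" "q \<noteq> 0" "z \<noteq> 0"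
  shows "aw_cert q a b c d (1 / z) = - aw_cert q a b c d (q * z)"
proof -
  \<comment> \<open>\<open>A\<close> and \<open>B\<close> are the common tails: three factors are
    split off the symbol of z^2 on one side and off that of 1/(qz)^2 on the other.\<close>
  define A where "A = qpoch_inf q (q ^ 3 * z\<^sup>2)"
  define B where "B = qpoch_inf q (q / z\<^sup>2)"
  have 1: "qpoch_inf q (z\<^sup>2) = (1 - z\<^sup>2) * (1 - q * z\<^sup>2) * (1 - q\<^sup>2 * z\<^sup>2) * A"
    using qpoch_inf_rec[OF assms(1), of "z\<^sup>2"] qpoch_inf_rec[OF assms(1), of "z\<^sup>2 * q"]
      qpoch_inf_rec[OF assms(1), of "z\<^sup>2 * q\<^sup>2"]
    by (simp add: A_def power2_eq_square power3_eq_cube mult_ac)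
  have 2: "qpoch_inf q (1 / (q\<^sup>2 * z\<^sup>2)) = (1 - 1 / (q\<^sup>2 * z\<^sup>2)) * (1 - 1 / (q * z\<^sup>2)) * (1 - 1 / z\<^sup>2) * B"
    using qpoch_inf_rec[OF assms(1), of "1 / (q\<^sup>2 * z\<^sup>2)"] qpoch_inf_rec[OF assms(1), of "1 / (q * z\<^sup>2)"]
      qpoch_inf_rec[OF assms(1), of "1 / z\<^sup>2"] assms(2)
    by (simp add: B_def power2_eq_square mult_ac)
  \<comment> \<open>For j = 0, 1, 2, the factor 1 - q^j z^2 is -q^j z^2 times 1 - 1/(q^j z^2).
    Together these constants give -q^3 z^6, and z^(-3) turns this into -(qz)^3.\<close>
  have 3: "(1 / z) ^ 3 * ((1 - z\<^sup>2) * (1 - q * z\<^sup>2) * (1 - q\<^sup>2 * z\<^sup>2)) =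
      - ((q * z) ^ 3 * ((1 - 1 / (q\<^sup>2 * z\<^sup>2)) * (1 - 1 / (q * z\<^sup>2)) * (1 - 1 / z\<^sup>2)))"
  proof -
    define y where "y = 1 / z"
    have zy: "z * y = 1" and y: "1 / z\<^sup>2 = y\<^sup>2"
      using assms(3) by (simp_all add: y_def power_divide)
    have *: "1 - t * z\<^sup>2 = - (z\<^sup>2 * (t - y\<^sup>2))" for t
      using zy by algebra
    have "y ^ 3 * ((1 - z\<^sup>2) * (1 - q * z\<^sup>2) * (1 - q\<^sup>2 * z\<^sup>2)) =
        - ((z * y) ^ 3 * z ^ 3 * ((1 - y\<^sup>2) * (q - y\<^sup>2) * (q\<^sup>2 - y\<^sup>2)))"
    proof -
      have "(1 - z\<^sup>2) * (1 - q * z\<^sup>2) * (1 - q\<^sup>2 * z\<^sup>2) =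
          - (z ^ 6 * ((1 - y\<^sup>2) * (q - y\<^sup>2) * (q\<^sup>2 - y\<^sup>2)))"
        using *[of 1] *[of q] *[of "q\<^sup>2"] by (simp add: mult_ac flip: power_add)
      then show ?thesis
        by (simp add: power_mult_distrib mult_ac flip: power_add)
    qed
    also have "q - y\<^sup>2 = q * (1 - 1 / (q * z\<^sup>2))"
      using assms(2) by (simp add: right_diff_distrib flip: y)
    also have "q\<^sup>2 - y\<^sup>2 = q\<^sup>2 * (1 - 1 / (q\<^sup>2 * z\<^sup>2))"
      using assms(2) by (simp add: right_diff_distrib flip: y)
    finally show ?thesis
      by (simp add: zy y_def power_divide power2_eq_square power3_eq_cube mult_ac)
  qed
  have num: "(1 / z) ^ 3 * qpoch_inf q (q * (1 / z)\<^sup>2) * qpoch_inf q (1 / (1 / z)\<^sup>2) =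
      - ((q * z) ^ 3 * qpoch_inf q (q * (q * z)\<^sup>2) * qpoch_inf q (1 / (q * z)\<^sup>2))"
  proof -
    have "(1 / z) ^ 3 * qpoch_inf q (q * (1 / z)\<^sup>2) * qpoch_inf q (1 / (1 / z)\<^sup>2) =
      (1 / z) ^ 3 * ((1 - z\<^sup>2) * (1 - q * z\<^sup>2) * (1 - q\<^sup>2 * z\<^sup>2)) * A * B"
      by (simp add: 1 B_def power_divide)
    moreover have "(q * z) ^ 3 * qpoch_inf q (q * (q * z)\<^sup>2) * qpoch_inf q (1 / (q * z)\<^sup>2) =
      (q * z) ^ 3 * ((1 - 1 / (q\<^sup>2 * z\<^sup>2)) * (1 - 1 / (q * z\<^sup>2)) * (1 - 1 / z\<^sup>2)) * A * B"
    proof -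
      have "q * (q * z)\<^sup>2 = q ^ 3 * z\<^sup>2" "(q * z)\<^sup>2 = q\<^sup>2 * z\<^sup>2"
        by (simp_all add: power2_eq_square power3_eq_cube mult_ac)
      then show ?thesis
        by (simp only: 2 A_def[symmetric] mult_ac)
    qed
    ultimately show ?thesis
      by (simp only: 3 mult_minus_left)
  qed
  have den: "qpoch_inf q (t * (1 / z)) * qpoch_inf q (t * q / (1 / z)) =
      qpoch_inf q (t * (q * z)) * qpoch_inf q (t * q / (q * z))" for t
    using assms(2) by (simp add: mult_ac)
  show ?thesis
    unfolding aw_cert_def num den by simp
qed

text \<open>With the weight divided out, the numerator contains the product of the z - t minus its
  reciprocal polynomial, the product of the 1 - tz. This difference is divisible by z^2 - 1, which
  cancels the remaining pole at z^2 = 1 and leaves an affine function of z + 1/z.\<close>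

lemma aw_cert_symmetrize:
  assumes "cmod q < 1" "cmod z = 1" "cmod a < 1" "cmod b < 1" "cmod c < 1" "cmod d < 1"
  shows "aw_cert q a b c d z + aw_cert q a b c d (1 / z) =
    - aw_weight q a b c d z * ((1 - a * b * c * d) * (z + 1 / z)
        - (a + b + c + d - (a * b * c + a * b * d + a * c * d + b * c * d)))"
proof -
  define A where "A = qpoch_inf q (q * z\<^sup>2) * qpoch_inf q (q / z\<^sup>2)"
  define y where "y = 1 / z"
  define D where "D = aw_factor q z a * aw_factor q z b * aw_factor q z c * aw_factor q z d"
  have z: "z \<noteq> 0" and zy: "z * y = 1"
    using assms(2) by (auto simp: y_def)
  have y: "t / z = t * y" "t / z\<^sup>2 = t * y\<^sup>2" for t
    by (simp_all add: y_def power_divide)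
  have "cmod y = 1"
    using assms(2) by (simp add: y_def norm_divide)
  have nz: "1 - t * z \<noteq> 0" "1 - t * y \<noteq> 0" if "cmod t < 1" for t
  proof -
    have "cmod (t * z) < 1" "cmod (t * y) < 1"
      using that assms(2) \<open>cmod y = 1\<close> by (simp_all add: norm_mult)
    then show "1 - t * z \<noteq> 0" "1 - t * y \<noteq> 0"
      by auto
  qed
  have D1: "1 / (qpoch_inf q (t * z) * qpoch_inf q (t * q / z)) = (1 - t * y) / aw_factor q z t"
    and D2: "1 / (qpoch_inf q (t * y) * qpoch_inf q (t * q / y)) = (1 - t * z) / aw_factor q z t"
    if "cmod t < 1" for t
  proof -
    have "aw_factor q z t = qpoch_inf q (t * z) * qpoch_inf q (t * y)"
      by (simp add: aw_factor_def y)
    moreover have "qpoch_inf q (t * z) = (1 - t * z) * qpoch_inf q (t * q / y)"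
      using qpoch_inf_rec[OF assms(1), of "t * z"] by (simp add: y_def mult_ac)
    moreover have "qpoch_inf q (t * y) = (1 - t * y) * qpoch_inf q (t * q / z)"
      using qpoch_inf_rec[OF assms(1), of "t * y"] by (simp add: y mult_ac)
    ultimately show
      "1 / (qpoch_inf q (t * z) * qpoch_inf q (t * q / z)) = (1 - t * y) / aw_factor q z t"
      "1 / (qpoch_inf q (t * y) * qpoch_inf q (t * q / y)) = (1 - t * z) / aw_factor q z t"
      using nz[OF that] by simp_all
  qed
  have "aw_cert q a b c d z = z ^ 3 * qpoch_inf q (q * z\<^sup>2) * qpoch_inf q (1 / z\<^sup>2) *
      ((1 / (qpoch_inf q (a * z) * qpoch_inf q (a * q / z))) * (1 / (qpoch_inf q (b * z) * qpoch_inf q (b * q / z))) *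
       (1 / (qpoch_inf q (c * z) * qpoch_inf q (c * q / z))) * (1 / (qpoch_inf q (d * z) * qpoch_inf q (d * q / z))))"
    by (simp add: aw_cert_def)
  also have "qpoch_inf q (1 / z\<^sup>2) = (1 - y\<^sup>2) * qpoch_inf q (q / z\<^sup>2)"
    using qpoch_inf_rec[OF assms(1), of "1 / z\<^sup>2"] by (simp add: y mult.commute)
  finally have 1: "aw_cert q a b c d z = A / D * (z ^ 3 * (1 - y\<^sup>2) * ((1 - a * y) * (1 - b * y) * (1 - c * y) * (1 - d * y)))"
    by (simp add: D1 assms A_def D_def)
  have "aw_cert q a b c d y = y ^ 3 * qpoch_inf q (q * y\<^sup>2) * qpoch_inf q (1 / y\<^sup>2) *
      ((1 / (qpoch_inf q (a * y) * qpoch_inf q (a * q / y))) * (1 / (qpoch_inf q (b * y) * qpoch_inf q (b * q / y))) *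
       (1 / (qpoch_inf q (c * y) * qpoch_inf q (c * q / y))) * (1 / (qpoch_inf q (d * y) * qpoch_inf q (d * q / y))))"
    by (simp add: aw_cert_def)
  also have "qpoch_inf q (1 / y\<^sup>2) = (1 - z\<^sup>2) * qpoch_inf q (q * z\<^sup>2)"
    using qpoch_inf_rec[OF assms(1), of "z\<^sup>2"] by (simp add: y_def power_divide mult_ac)
  finally have 2: "aw_cert q a b c d y = A / D * (y ^ 3 * (1 - z\<^sup>2) * ((1 - a * z) * (1 - b * z) * (1 - c * z) * (1 - d * z)))"
    by (simp add: D2 assms A_def D_def y)
  have "aw_factor q (z\<^sup>2) 1 = (1 - z\<^sup>2) * (1 - y\<^sup>2) * A"
    using aw_factor_rec[OF assms(1), of "z\<^sup>2" 1] by (simp add: A_def aw_factor_def y)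
  then have 3: "aw_weight q a b c d z = A / D * ((1 - z\<^sup>2) * (1 - y\<^sup>2))"
    by (simp add: aw_weight_def D_def)
  have "z ^ 3 * (1 - y\<^sup>2) * ((1 - a * y) * (1 - b * y) * (1 - c * y) * (1 - d * y)) +
      y ^ 3 * (1 - z\<^sup>2) * ((1 - a * z) * (1 - b * z) * (1 - c * z) * (1 - d * z)) =
    - ((1 - z\<^sup>2) * (1 - y\<^sup>2) * ((1 - a * b * c * d) * (z + y)
        - (a + b + c + d - (a * b * c + a * b * d + a * c * d + b * c * d))))"
  proof -
    \<comment> \<open>With y = 1/z known only through zy = 1, all terms are brought to powers of y
      times polynomials in z. The last equation gives the constant term this shape too.\<close>
    have e: "1 - t * y = y * (z - t)" "1 - y\<^sup>2 = y\<^sup>2 * (z\<^sup>2 - 1)" "z + y = y * (z\<^sup>2 + 1)"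
        "w = y * (z * w)" for t w
      using zy by algebra+
    have "z ^ 3 * (1 - y\<^sup>2) * ((1 - a * y) * (1 - b * y) * (1 - c * y) * (1 - d * y)) +
        y ^ 3 * (1 - z\<^sup>2) * ((1 - a * z) * (1 - b * z) * (1 - c * z) * (1 - d * z)) =
      (z * y) ^ 3 * (y ^ 3 * (z\<^sup>2 - 1) * ((z - a) * (z - b) * (z - c) * (z - d))) +
        y ^ 3 * (1 - z\<^sup>2) * ((1 - a * z) * (1 - b * z) * (1 - c * z) * (1 - d * z))"
      unfolding e(1,2) by algebra
    also have "\<dots> = y ^ 3 * ((z\<^sup>2 - 1) * ((z - a) * (z - b) * (z - c) * (z - d) -
        (1 - a * z) * (1 - b * z) * (1 - c * z) * (1 - d * z)))"
      unfolding zy power_one mult_1_left by algebra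
    \<comment> \<open>The second elementary symmetric polynomial cancels in the difference of the
      two products; only those of degree 1, 3 and 4 remain, and a second factor z^2 - 1 splits
      off.\<close>
    also have "(z\<^sup>2 - 1) * ((z - a) * (z - b) * (z - c) * (z - d) -
        (1 - a * z) * (1 - b * z) * (1 - c * z) * (1 - d * z)) =
      (z\<^sup>2 - 1)\<^sup>2 * ((1 - a * b * c * d) * (z\<^sup>2 + 1)
        - z * (a + b + c + d - (a * b * c + a * b * d + a * c * d + b * c * d)))"
      by algebra
    also have "y ^ 3 * \<dots> = - ((1 - z\<^sup>2) * (y\<^sup>2 * (z\<^sup>2 - 1)) * ((1 - a * b * c * d) * (y * (z\<^sup>2 + 1))
        - y * (z * (a + b + c + d - (a * b * c + a * b * d + a * c * d + b * c * d)))))"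
      by algebra
    finally show ?thesis
      unfolding e(2,3) e(4)[of "a + b + c + d - (a * b * c + a * b * d + a * c * d + b * c * d)", symmetric] .
  qed
  then have "A / D * (z ^ 3 * (1 - y\<^sup>2) * ((1 - a * y) * (1 - b * y) * (1 - c * y) * (1 - d * y)) +
      y ^ 3 * (1 - z\<^sup>2) * ((1 - a * z) * (1 - b * z) * (1 - c * z) * (1 - d * z))) =
    A / D * - ((1 - z\<^sup>2) * (1 - y\<^sup>2) * ((1 - a * b * c * d) * (z + y)
        - (a + b + c + d - (a * b * c + a * b * d + a * c * d + b * c * d))))"
    by simp
  then show ?thesis
    unfolding y_def[symmetric] 1 2 3 by (simp only: distrib_left mult_minus_left mult_minus_right mult.assoc)
qed

text \<open>The mean over |z| = 1 equals the mean over |z| = |q| by shifting the contour, and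
  \<open>aw_cert_inverse\<close> with the reflection of theta turns the latter into minus the
  former.\<close>

lemma aw_cert_integral_eq_0_base_nonzero:
  assumes "cmod q < 1" "q \<noteq> 0" "cmod a < 1" "cmod b < 1" "cmod c < 1" "cmod d < 1"
  shows "integral {-pi..pi} (\<lambda>\<theta>. aw_cert q a b c d (cis \<theta>)) = 0"
proof -
  \<comment> \<open>A common bound for the parameters; the entry 1/2 keeps it positive, so that
    \<open>ln r\<close> is meaningful even if all of them vanish.\<close>
  define r where "r = Max {cmod a, cmod b, cmod c, cmod d, 1 / 2}"
  have r: "0 < r" "r < 1" and le: "cmod a \<le> r" "cmod b \<le> r" "cmod c \<le> r" "cmod d \<le> r"
    using assms by (auto simp: r_def less_max_iff_disj)
  \<comment> \<open>Under z = exp s, the strip l < Re s < -ln r is the annulus |q| r < |z| < 1/r.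
    There |tz| < 1 and |tq/z| < 1, so no denominator vanishes, and as r < 1 it contains both
    circles.\<close>
  define l where "l = ln (cmod q) + ln r"
  have nz: "qpoch_inf q (t * exp s) \<noteq> 0" "qpoch_inf q (t * q / exp s) \<noteq> 0"
    if "s \<in> {s. l < Re s \<and> Re s < - ln r}" "cmod t \<le> r" for s t
  proof -
    have "exp (Re s) < exp (- ln r)"
      using that by simp
    then have "r * exp (Re s) < 1"
      using r by (simp add: exp_minus field_simps)
    moreover have "cmod (t * exp s) \<le> r * exp (Re s)"
      using that(2) by (simp add: norm_mult)
    ultimately show "qpoch_inf q (t * exp s) \<noteq> 0"
      by (intro qpoch_inf_nonzero assms) simp
    have "exp l < exp (Re s)"
      using that by simp
    then have "r * cmod q < exp (Re s)"
      using r assms(2) by (simp add: l_def exp_add mult.commute)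
    moreover have "cmod (t * q / exp s) \<le> r * cmod q / exp (Re s)"
      using that(2) by (simp add: norm_mult norm_divide divide_right_mono mult_right_mono)
    ultimately show "qpoch_inf q (t * q / exp s) \<noteq> 0"
      by (intro qpoch_inf_nonzero assms) (simp add: divide_less_eq order.strict_trans1)
  qed
  have hol: "(\<lambda>s. aw_cert q a b c d (exp s)) holomorphic_on {s. l < Re s \<and> Re s < - ln r}"
    unfolding aw_cert_def using nz le by (intro holomorphic_intros assms) auto
  have "integral {-pi..pi} (\<lambda>\<theta>. aw_cert q a b c d (exp (0 + \<i> * complex_of_real \<theta>))) =
      integral {-pi..pi} (\<lambda>\<theta>. aw_cert q a b c d (exp (Ln q + \<i> * complex_of_real \<theta>)))"
  proof (rule integral_vertical_segment_eq[OF hol])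
    have "ln (cmod q) < 0" "ln r < 0"
      using assms(1,2) r by simp_all
    then show "l < Re 0" "Re 0 < - ln r" "l < Re (Ln q)" "Re (Ln q) < - ln r"
      unfolding l_def zero_complex.sel Re_Ln[OF assms(2)] by linarith+
  qed (simp add: exp_add)
  \<comment> \<open>Since exp (Ln q) = q, the second segment runs over q cis theta, where
    \<open>aw_cert_inverse\<close> applies with z = cis theta.\<close>
  also have "\<dots> = - integral {-pi..pi} (\<lambda>\<theta>. aw_cert q a b c d (cis (- \<theta>)))"
  proof -
    have "aw_cert q a b c d (exp (Ln q + \<i> * complex_of_real \<theta>)) = - aw_cert q a b c d (cis (- \<theta>))" for \<theta>
    proof -
      have "cis (- \<theta>) = 1 / cis \<theta>"
        by (simp add: inverse_eq_divide flip: cis_inverse)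
      then show ?thesis
        using aw_cert_inverse[OF assms(1,2), of "cis \<theta>" a b c d] assms(2)
        by (simp add: exp_add cis_conv_exp)
    qed
    then show ?thesis
      by simp
  qed
  also have "integral {-pi..pi} (\<lambda>\<theta>. aw_cert q a b c d (cis (- \<theta>))) =
      integral {-pi..pi} (\<lambda>\<theta>. aw_cert q a b c d (cis \<theta>))"
    using Henstock_Kurzweil_Integration.integral_reflect_real[of pi "-pi" "\<lambda>\<theta>. aw_cert q a b c d (cis \<theta>)"] by simp
  finally show ?thesis
    by (simp add: cis_conv_exp)
qed

text \<open>The circle |z| = |q| collapses to a point, but the function is now z k(z) with
  \<open>k\<close> holomorphic on a disc of radius 1/r > 1. The factor z comes from dz = i z d
  theta, so a primitive of \<open>k\<close> gives the value zero.\<close>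

lemma aw_cert_integral_eq_0_base_0:
  assumes "cmod a < 1" "cmod b < 1" "cmod c < 1" "cmod d < 1"
  shows "integral {-pi..pi} (\<lambda>\<theta>. aw_cert 0 a b c d (cis \<theta>)) = 0"
proof -
  define k where "k = (\<lambda>z. (z\<^sup>2 - 1) / ((1 - a * z) * (1 - b * z) * (1 - c * z) * (1 - d * z)))"
  define r where "r = Max {cmod a, cmod b, cmod c, cmod d, 1 / 2}"
  have r: "0 < r" "r < 1" and le: "cmod a \<le> r" "cmod b \<le> r" "cmod c \<le> r" "cmod d \<le> r"
    using assms by (auto simp: r_def less_max_iff_disj)
  have nz: "1 - t * z \<noteq> 0" if "z \<in> ball 0 (1 / r)" "cmod t \<le> r" for t z
  proof -
    have "cmod (t * z) \<le> r * cmod z"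
      using that by (simp add: norm_mult mult_right_mono)
    also have "\<dots> < 1"
      using that r by (simp add: field_simps)
    finally show ?thesis
      by auto
  qed
  have "k holomorphic_on ball 0 (1 / r)"
    unfolding k_def using nz le by (intro holomorphic_intros) auto
  then obtain K where "\<And>z. z \<in> ball 0 (1 / r) \<Longrightarrow> (K has_field_derivative k z) (at z within ball 0 (1 / r))"
    using holomorphic_convex_primitive'[OF convex_ball open_ball] by blast
  then have K: "(K has_field_derivative k z) (at z)" if "z \<in> ball 0 (1 / r)" for z
    using that by (metis at_within_open open_ball)
  have "((\<lambda>s. K (exp s)) has_field_derivative k (exp (0 + \<i> * complex_of_real \<theta>)) * exp (0 + \<i> * complex_of_real \<theta>))
      (at (0 + \<i> * complex_of_real \<theta>))" for \<theta>
    using r by (intro DERIV_chain2[OF K]) (auto intro!: derivative_eq_intros simp: field_simps)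
  from has_integral_vertical_segment[OF this]
  have "((\<lambda>\<theta>. k (cis \<theta>) * cis \<theta>) has_integral 0) {-pi..pi}"
    by (simp add: cis_conv_exp exp_minus)
  moreover have "aw_cert 0 a b c d (cis \<theta>) = k (cis \<theta>) * cis \<theta>" for \<theta>
  proof -
    have "cis \<theta> ^ 3 * (1 - 1 / (cis \<theta>)\<^sup>2) = ((cis \<theta>)\<^sup>2 - 1) * cis \<theta>"
      by (simp add: right_diff_distrib left_diff_distrib power2_eq_square power3_eq_cube)
    then show ?thesis
      by (simp add: aw_cert_def k_def qpoch_inf_zero_left)
  qed
  ultimately show ?thesis
    by (simp add: integral_unique)
qed

lemma aw_cert_integral_eq_0:
  assumes "cmod q < 1" "cmod a < 1" "cmod b < 1" "cmod c < 1" "cmod d < 1"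
  shows "integral {-pi..pi} (\<lambda>\<theta>. aw_cert q a b c d (cis \<theta>)) = 0"
  using aw_cert_integral_eq_0_base_nonzero aw_cert_integral_eq_0_base_0 assms by (cases "q = 0") simp_all

section \<open>Continuity in the angle and the parameters\<close>

lemma continuous_on_aw_factor [continuous_intros]:
  assumes "cmod q < 1" "continuous_on A z" "continuous_on A a" "\<And>x. x \<in> A \<Longrightarrow> cmod (z x) = 1"
  shows "continuous_on A (\<lambda>x. aw_factor q (z x) (a x))"
  unfolding aw_factor_def using assms by (intro continuous_intros) force+

lemma continuous_on_aw_weight:
  assumes "cmod q < 1" "continuous_on A z" "\<And>x. x \<in> A \<Longrightarrow> cmod (z x) = 1"
    and "continuous_on A a" "continuous_on A b" "continuous_on A c" "continuous_on A d"
    and "\<And>x. x \<in> A \<Longrightarrow> cmod (a x) < 1" "\<And>x. x \<in> A \<Longrightarrow> cmod (b x) < 1"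
      "\<And>x. x \<in> A \<Longrightarrow> cmod (c x) < 1" "\<And>x. x \<in> A \<Longrightarrow> cmod (d x) < 1"
  shows "continuous_on A (\<lambda>x. aw_weight q (a x) (b x) (c x) (d x) (z x))"
  unfolding aw_weight_def using assms
  by (intro continuous_intros) (auto simp: norm_power aw_factor_nonzero)

lemma continuous_on_aw_cert_cis:
  assumes "cmod q < 1" "cmod a < 1" "cmod b < 1" "cmod c < 1" "cmod d < 1"
  shows "continuous_on A (\<lambda>\<theta>. aw_cert q a b c d (cis \<theta>))"
proof -
  have "cmod (t * q) < 1" if "cmod t < 1" for t
    using mult_strict_mono'[of "cmod t" 1 "cmod q" 1] that assms(1) by (simp add: norm_mult)
  then have "qpoch_inf q (t * cis \<theta>) \<noteq> 0" "qpoch_inf q (t * q / cis \<theta>) \<noteq> 0" if "cmod t < 1" for t \<theta>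
    using that assms(1) by (auto simp: norm_mult norm_divide qpoch_inf_nonzero)
  then show ?thesis
    unfolding aw_cert_def using assms by (intro continuous_intros) auto
qed

text \<open>The vanishing mean of \<open>aw_cert\<close> is folded onto the half circle by theta ->
  -theta, that is z -> 1/z, and \<open>aw_cert_symmetrize\<close> identifies the folded
  integrand.\<close>

lemma aw_integral_moment:
  assumes "cmod q < 1" "cmod a < 1" "cmod b < 1" "cmod c < 1" "cmod d < 1"
  shows "integral {0..pi} (\<lambda>\<theta>. aw_weight q a b c d (cis \<theta>) *
      ((1 - a * b * c * d) * (cis \<theta> + 1 / cis \<theta>)
        - (a + b + c + d - (a * b * c + a * b * d + a * c * d + b * c * d)))) = 0"
proof -
  define F where "F = (\<lambda>\<theta>. aw_cert q a b c d (cis \<theta>))"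
  have cont: "continuous_on A F" for A
    unfolding F_def by (intro continuous_on_aw_cert_cis assms)
  have cont': "continuous_on A (\<lambda>\<theta>. F (- \<theta>))" for A
    using continuous_on_compose2[OF cont[of UNIV], of A uminus] by (simp add: continuous_on_minus)
  have "0 = integral {-pi..0} F + integral {0..pi} F"
    using aw_cert_integral_eq_0[OF assms] integrable_continuous_interval[OF cont]
    by (simp add: F_def Henstock_Kurzweil_Integration.integral_combine)
  also have "integral {-pi..0} F = integral {0..pi} (\<lambda>\<theta>. F (- \<theta>))"
    using Henstock_Kurzweil_Integration.integral_reflect_real[of 0 "pi" F]
      Henstock_Kurzweil_Integration.integral_reflect_real[of pi 0 "\<lambda>\<theta>. F (- \<theta>)"] by simp
  also have "\<dots> + integral {0..pi} F = integral {0..pi} (\<lambda>\<theta>. F (- \<theta>) + F \<theta>)"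
    by (intro Henstock_Kurzweil_Integration.integral_add[symmetric] integrable_continuous_interval cont cont')
  also have "(\<lambda>\<theta>. F (- \<theta>) + F \<theta>) = (\<lambda>\<theta>. - (aw_weight q a b c d (cis \<theta>) *
      ((1 - a * b * c * d) * (cis \<theta> + 1 / cis \<theta>)
        - (a + b + c + d - (a * b * c + a * b * d + a * c * d + b * c * d)))))"
  proof
    fix \<theta>
    have "cis (- \<theta>) = 1 / cis \<theta>"
      by (simp add: inverse_eq_divide flip: cis_inverse)
    then have "F (- \<theta>) + F \<theta> = aw_cert q a b c d (cis \<theta>) + aw_cert q a b c d (1 / cis \<theta>)"
      by (simp add: F_def)
    also note aw_cert_symmetrize[OF assms(1) _ assms(2-), of "cis \<theta>"]
    finally show "F (- \<theta>) + F \<theta> = - (aw_weight q a b c d (cis \<theta>) *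
      ((1 - a * b * c * d) * (cis \<theta> + 1 / cis \<theta>)
        - (a + b + c + d - (a * b * c + a * b * d + a * c * d + b * c * d))))"
      by simp
  qed
  finally show ?thesis
    by simp
qed

text \<open>Replacing a by aq multiplies the weight by an affine function of z + 1/z. Eliminating z
  + 1/z with \<open>aw_integral_moment\<close> relates the two integrals.\<close>

lemma aw_integral_shift:
  assumes "cmod q < 1" "cmod a < 1" "cmod b < 1" "cmod c < 1" "cmod d < 1"
  shows "(1 - a * b * c * d) * aw_integral q (a * q) b c d =
    (1 - a * b) * (1 - a * c) * (1 - a * d) * aw_integral q a b c d"
proof -
  define w where "w = (\<lambda>\<theta>. aw_weight q a b c d (cis \<theta>))"
  define w' where "w' = (\<lambda>\<theta>. aw_weight q (a * q) b c d (cis \<theta>))"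
  have aq: "cmod (a * q) < 1"
    using mult_strict_mono'[of "cmod a" 1 "cmod q" 1] assms by (simp add: norm_mult)
  have "continuous_on A w" "continuous_on A w'" for A
    unfolding w_def w'_def using assms aq by (intro continuous_on_aw_weight continuous_intros; simp)+
  then have int: "w integrable_on {0..pi}" "w' integrable_on {0..pi}"
    by (auto intro: integrable_continuous_interval)
  have "w' \<theta> = w \<theta> * ((1 - a * cis \<theta>) * (1 - a / cis \<theta>))" for \<theta>
    using aw_factor_rec[OF assms(1), of "cis \<theta>" a] aw_factor_nonzero[OF assms(1,2), of "cis \<theta>"]
    by (simp add: w_def w'_def aw_weight_def)
  moreover have "(1 - a * cis \<theta>) * (1 - a / cis \<theta>) = 1 + a\<^sup>2 - a * (cis \<theta> + 1 / cis \<theta>)" for \<theta>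
    by (simp add: field_simps power2_eq_square)
  ultimately have w': "w' \<theta> = w \<theta> * (1 + a\<^sup>2 - a * (cis \<theta> + 1 / cis \<theta>))" for \<theta>
    by simp
  \<comment> \<open>The coefficients are chosen so that the difference is exactly \<open>a\<close>
    times the integrand of \<open>aw_integral_moment\<close>.\<close>
  have "(1 - a * b) * (1 - a * c) * (1 - a * d) * w \<theta> - (1 - a * b * c * d) * w' \<theta> =
      a * (w \<theta> * ((1 - a * b * c * d) * (cis \<theta> + 1 / cis \<theta>)
        - (a + b + c + d - (a * b * c + a * b * d + a * c * d + b * c * d))))" for \<theta>
    unfolding w' by algebra
  then have "integral {0..pi} (\<lambda>\<theta>. (1 - a * b) * (1 - a * c) * (1 - a * d) * w \<theta> - (1 - a * b * c * d) * w' \<theta>) = 0"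
    using aw_integral_moment[OF assms] by (simp add: w_def)
  then have "integral {0..pi} (\<lambda>\<theta>. (1 - a * b) * (1 - a * c) * (1 - a * d) * w \<theta>) =
      integral {0..pi} (\<lambda>\<theta>. (1 - a * b * c * d) * w' \<theta>)"
    using int by (subst (asm) Henstock_Kurzweil_Integration.integral_diff) (auto intro: integrable_on_mult_right)
  then show ?thesis
    by (simp add: aw_integral_def w_def w'_def)
qed

text \<open>This permits the limit a q^n -> 0 when the shift relation is iterated.\<close>

lemma continuous_on_aw_integral:
  assumes "cmod q < 1" "cmod b < 1" "cmod c < 1" "cmod d < 1"
  shows "continuous_on (ball 0 1) (\<lambda>a. aw_integral q a b c d)"
proof -
  have "continuous_on (ball 0 1 \<times> cbox 0 pi) (\<lambda>x. aw_weight q (fst x) b c d (cis (snd x)))"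
    using assms by (intro continuous_on_aw_weight continuous_intros) auto
  then show ?thesis
    unfolding aw_integral_def
    using integral_continuous_on_param[of "ball 0 1" 0 pi "\<lambda>a \<theta>. aw_weight q a b c d (cis \<theta>)"]
    by (simp add: case_prod_beta)
qed

subsection \<open>Evaluation of the Askey--Wilson integral\<close>

text \<open>The integral times the denominator of its expected value. In this normalization the
  shift in \<open>a\<close> costs only the factor 1 - abcd.\<close>

definition aw_norm :: "complex \<Rightarrow> complex \<Rightarrow> complex \<Rightarrow> complex \<Rightarrow> complex \<Rightarrow> complex" where
  "aw_norm q a b c d = aw_integral q a b c d *
     (qpoch_inf q (a * b) * qpoch_inf q (a * c) * qpoch_inf q (a * d) *
      qpoch_inf q (b * c) * qpoch_inf q (b * d) * qpoch_inf q (c * d))"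

lemma aw_norm_shift:
  assumes "cmod q < 1" "cmod a < 1" "cmod b < 1" "cmod c < 1" "cmod d < 1"
  shows "aw_norm q a b c d = (1 - a * b * c * d) * aw_norm q (a * q) b c d"
proof -
  have "qpoch_inf q (a * t) = (1 - a * t) * qpoch_inf q (a * q * t)" for t
    using qpoch_inf_rec[OF assms(1), of "a * t"] by (simp add: mult_ac)
  note * = this[of b] this[of c] this[of d]
  show ?thesis
    unfolding aw_norm_def * using aw_integral_shift[OF assms] by algebra
qed

text \<open>Iterating \<open>aw_norm_shift\<close> n times produces a partial product of (abcd; q),
  and continuity at a = 0 gives the limit.\<close>

lemma aw_norm_eq_mult_zero:
  assumes "cmod q < 1" "cmod a < 1" "cmod b < 1" "cmod c < 1" "cmod d < 1"
  shows "aw_norm q a b c d = qpoch_inf q (a * b * c * d) * aw_norm q 0 b c d"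
proof -
  have bound: "cmod (a * q ^ n) < 1" for n
  proof -
    have "cmod a * cmod q ^ n \<le> cmod a * 1"
      using assms by (intro mult_left_mono power_le_one) auto
    then show ?thesis
      using assms(2) by (simp add: norm_mult norm_power)
  qed
  have eq: "aw_norm q a b c d = (\<Prod>k<n. 1 - a * b * c * d * q ^ k) * aw_norm q (a * q ^ n) b c d" for n
  proof (induction n)
    case (Suc n)
    show ?case
      using Suc aw_norm_shift[OF assms(1) bound[of n] assms(3-)] by (simp add: mult_ac)
  qed simp
  have "(\<lambda>n. a * q ^ n) \<longlonglongrightarrow> a * 0"
    using assms(1) by (intro tendsto_intros LIMSEQ_power_zero)
  moreover have cont: "continuous_on (ball 0 1) (\<lambda>a. aw_norm q a b c d)"
    unfolding aw_norm_def using assms by (intro continuous_intros continuous_on_aw_integral)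
  ultimately have "(\<lambda>n. aw_norm q (a * q ^ n) b c d) \<longlonglongrightarrow> aw_norm q 0 b c d"
    using continuous_on_tendsto_compose[OF cont, of "\<lambda>n. a * q ^ n" 0 sequentially] bound by simp
  from tendsto_mult[OF qpoch_inf_LIMSEQ[OF assms(1), of "a * b * c * d"] this]
  have "(\<lambda>n. aw_norm q a b c d) \<longlonglongrightarrow> qpoch_inf q (a * b * c * d) * aw_norm q 0 b c d"
    by (simp add: eq[symmetric])
  then show ?thesis
    by (simp add: LIMSEQ_const_iff)
qed

text \<open>By symmetry each further parameter can be moved to the first place and sent to 0. From
  the second time on a zero parameter is present, so the Pochhammer factor is 1.\<close>

lemma aw_norm_eq_mult_base:
  assumes "cmod q < 1" "cmod a < 1" "cmod b < 1" "cmod c < 1" "cmod d < 1"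
  shows "aw_norm q a b c d = qpoch_inf q (a * b * c * d) * aw_norm q 0 0 0 0"
proof -
  have "aw_norm q 0 b c d = aw_norm q b 0 c d" "aw_norm q 0 0 c d = aw_norm q c 0 0 d"
    "aw_norm q 0 0 0 d = aw_norm q d 0 0 0"
    by (simp_all add: aw_norm_def aw_integral_def aw_weight_def mult_ac)
  then show ?thesis
    using aw_norm_eq_mult_zero[OF assms] aw_norm_eq_mult_zero[of q b 0 c d]
      aw_norm_eq_mult_zero[of q c 0 0 d] aw_norm_eq_mult_zero[of q d 0 0 0] assms
    by simp
qed

text \<open>At these parameters the weight degenerates to the elementary function
  \<open>(1 - z\<^sup>2) (1 - z\<^sup>-\<^sup>2)\<close>, which fixes the normalization without the Jacobi triple product.\<close>

lemma aw_weight_special: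
  assumes "cmod q < 1" "s\<^sup>2 = q" "cmod z = 1"
  shows "aw_weight q q (- q) s (- s) z = (1 - z\<^sup>2) * (1 - 1 / z\<^sup>2)"
proof -
  have prod: "qpoch_inf q (q * x) * qpoch_inf q (- q * x) * (qpoch_inf q (s * x) * qpoch_inf q (- s * x)) =
      qpoch_inf q (q * x\<^sup>2)" for x
  proof -
    have "qpoch_inf q (q * x) * qpoch_inf q (- q * x) = qpoch_inf (q\<^sup>2) (q * x\<^sup>2 * q)"
      using qpoch_inf_mult_uminus[OF assms(1), of "q * x"]
      by (simp add: power2_eq_square mult_ac)
    moreover have "qpoch_inf q (s * x) * qpoch_inf q (- s * x) = qpoch_inf (q\<^sup>2) (q * x\<^sup>2)"
      using qpoch_inf_mult_uminus[OF assms(1), of "s * x"]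
      by (simp add: power_mult_distrib assms(2))
    ultimately show ?thesis
      using qpoch_inf_even_odd[OF assms(1), of "q * x\<^sup>2"] by (simp only: mult.commute)
  qed
  have "aw_factor q z q * aw_factor q z (- q) * aw_factor q z s * aw_factor q z (- s) =
      qpoch_inf q (q * z\<^sup>2) * qpoch_inf q (q * (1 / z)\<^sup>2)"
    unfolding prod[symmetric] by (simp add: aw_factor_def mult_ac)
  also have "\<dots> = aw_factor q (z\<^sup>2) q"
    by (simp add: aw_factor_def power_divide)
  finally have "aw_weight q q (- q) s (- s) z = aw_factor q (z\<^sup>2) 1 / aw_factor q (z\<^sup>2) q"
    by (simp add: aw_weight_def)
  then show ?thesis
    using aw_factor_rec[OF assms(1), of "z\<^sup>2" 1] aw_factor_nonzero[OF assms(1,1), of "z\<^sup>2"] assms(3)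
    by (simp add: norm_power)
qed

lemma aw_integral_special:
  assumes "cmod q < 1" "s\<^sup>2 = q"
  shows "aw_integral q q (- q) s (- s) = 2 * complex_of_real pi"
proof -
  have "aw_weight q q (- q) s (- s) (cis \<theta>) = complex_of_real (2 - 2 * cos (2 * \<theta>))" for \<theta>
  proof -
    have "(cis \<theta>)\<^sup>2 = cis (2 * \<theta>)" "1 / (cis \<theta>)\<^sup>2 = cis (- (2 * \<theta>))"
      by (simp_all add: Complex.DeMoivre inverse_eq_divide flip: cis_inverse)
    then have "aw_weight q q (- q) s (- s) (cis \<theta>) = (1 - cis (2 * \<theta>)) * (1 - cis (- (2 * \<theta>)))"
      using aw_weight_special[OF assms, of "cis \<theta>"] by simp
    also have "\<dots> = complex_of_real (2 - 2 * cos (2 * \<theta>))"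
      by (simp add: algebra_simps cis_mult) (simp add: complex_eq_iff)
    finally show ?thesis .
  qed
  moreover have "((\<lambda>\<theta>. 2 - 2 * cos (2 * \<theta>)) has_integral (2 * pi - sin (2 * pi)) - (2 * 0 - sin (2 * 0))) {0..pi}"
    by (intro fundamental_theorem_of_calculus)
      (auto intro!: derivative_eq_intros simp flip: has_real_derivative_iff_has_vector_derivative)
  then have "((\<lambda>\<theta>. 2 - 2 * cos (2 * \<theta>)) has_integral 2 * pi) {0..pi}"
    by simp
  then have "((\<lambda>\<theta>. complex_of_real (2 - 2 * cos (2 * \<theta>))) has_integral complex_of_real (2 * pi)) {0..pi}"
    by (rule has_integral_of_real)
  ultimately show ?thesis
    by (simp add: aw_integral_def integral_unique)
qed

text \<open>\<open>aw_norm\<close> at the parameters q, -q, s, -s with s^2 = q is computed twice: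
  through \<open>aw_norm_eq_mult_base\<close> and through the explicit integral 2 pi. Euler's
  identity reduces the remaining products to 1.\<close>

lemma aw_norm_base:
  assumes "cmod q < 1"
  shows "qpoch_inf q q * aw_norm q 0 0 0 0 = 2 * complex_of_real pi"
proof -
  define s where "s = csqrt q"
  have s: "s\<^sup>2 = q"
    by (simp add: s_def)
  have "cmod s < 1"
    using assms by (metis norm_power norm_ge_zero not_less one_le_power s)
  define X where "X = qpoch_inf (q\<^sup>2) (q ^ 3)"
  define Y where "Y = qpoch_inf q (- (q\<^sup>2))"
  define Z where "Z = qpoch_inf q (q ^ 3)"
  have q2: "cmod (q\<^sup>2) < 1"
    using assms by (simp add: norm_power power_less_one_iff)
  have ss: "s * s = q"
    using s by (simp add: power2_eq_square)
  have Z: "qpoch_inf q q = (1 - q) * (1 - q\<^sup>2) * Z"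
    using qpoch_inf_rec[OF assms, of q] qpoch_inf_rec[OF assms, of "q\<^sup>2"]
    by (simp add: Z_def power2_eq_square power3_eq_cube mult_ac)
  have Y: "qpoch_inf q (- q) = (1 + q) * Y"
    using qpoch_inf_rec[OF assms, of "- q"] by (simp add: Y_def power2_eq_square)
  have "qpoch_inf (q\<^sup>2) q = (1 - q) * X"
    using qpoch_inf_rec[OF q2, of q] by (simp add: X_def power2_eq_square power3_eq_cube mult_ac)
  then have E: "(1 - q) * X * ((1 + q) * Y) = 1"
    using qpoch_inf_euler[OF assms] Y by simp
  have X: "qpoch_inf q (q * s) * qpoch_inf q (- (q * s)) = X"
    using qpoch_inf_mult_uminus[OF assms, of "q * s"]
    by (simp add: X_def power_mult_distrib s) (simp add: power2_eq_square power3_eq_cube mult_ac)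
  have "aw_norm q q (- q) s (- s) = qpoch_inf q (q * (- q) * s * (- s)) * aw_norm q 0 0 0 0"
    by (intro aw_norm_eq_mult_base) (use assms \<open>cmod s < 1\<close> in simp_all)
  also have "q * (- q) * s * (- s) = q * q * (s * s)"
    by simp
  also have "\<dots> = q ^ 3"
    by (simp only: ss power3_eq_cube)
  finally have "aw_norm q q (- q) s (- s) = Z * aw_norm q 0 0 0 0"
    by (simp only: Z_def)
  \<comment> \<open>Of the six pairwise products, ab = -q^2 gives \<open>Y\<close>, cd = -q gives
    the last symbol, and each of qs and -qs occurs twice, hence the square.\<close>
  moreover have "aw_norm q q (- q) s (- s) = 2 * complex_of_real pi *
      (Y * (qpoch_inf q (q * s) * qpoch_inf q (- (q * s)))\<^sup>2 * qpoch_inf q (- q))"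
    unfolding aw_norm_def aw_integral_special[OF assms s] Y_def
    by (simp add: ss) (simp add: power2_eq_square mult_ac)
  ultimately have N: "Z * aw_norm q 0 0 0 0 = 2 * complex_of_real pi * (Y * X\<^sup>2 * ((1 + q) * Y))"
    unfolding X Y by simp
  have "qpoch_inf q q * aw_norm q 0 0 0 0 = (1 - q) * (1 - q\<^sup>2) * (Z * aw_norm q 0 0 0 0)"
    by (simp add: Z mult_ac)
  \<comment> \<open>As 1 - q^2 = (1 - q)(1 + q), all factors assemble into the square of the left
    side of Euler's identity \<open>E\<close>.\<close>
  also have "\<dots> = 2 * complex_of_real pi * ((1 - q) * X * ((1 + q) * Y))\<^sup>2"
    unfolding N by algebra
  finally show ?thesis
    by (simp add: E)
qed

theorem askey_wilson_integral:
  assumes "cmod q < 1" "cmod a < 1" "cmod b < 1" "cmod c < 1" "cmod d < 1"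
  shows "qpoch_inf q q / (2 * complex_of_real pi) * aw_integral q a b c d =
    qpoch_inf q (a * b * c * d) /
      (qpoch_inf q (a * b) * qpoch_inf q (a * c) * qpoch_inf q (a * d) *
       qpoch_inf q (b * c) * qpoch_inf q (b * d) * qpoch_inf q (c * d))"
proof -
  define D where "D = qpoch_inf q (a * b) * qpoch_inf q (a * c) * qpoch_inf q (a * d) *
      qpoch_inf q (b * c) * qpoch_inf q (b * d) * qpoch_inf q (c * d)"
  have "qpoch_inf q (x * y) \<noteq> 0" if "cmod x < 1" "cmod y < 1" for x y
    using mult_strict_mono'[of "cmod x" 1 "cmod y" 1] that
    by (intro qpoch_inf_nonzero assms) (simp add: norm_mult)
  then have "D \<noteq> 0"
    using assms by (simp add: D_def)
  moreover have "qpoch_inf q q * (aw_integral q a b c d * D) = 2 * complex_of_real pi * qpoch_inf q (a * b * c * d)"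
    using aw_norm_eq_mult_base[OF assms] aw_norm_base[OF assms(1)]
    by (simp add: aw_norm_def D_def mult.left_commute)
  ultimately show ?thesis
    unfolding D_def[symmetric] by (simp add: divide_simps mult_ac)
qed

subsection \<open>Integration of Jackson sums\<close>

text \<open>Since r < 1, the weight is bounded for |d| <= r and theta in [0, pi] by compactness. The
  Weierstrass test then gives uniform convergence, which justifies integrating term by term.\<close>

lemma aw_integral_sums:
  fixes x \<alpha> :: "nat \<Rightarrow> complex"
  assumes "cmod q < 1" "cmod a < 1" "cmod b < 1" "cmod c < 1"
    and "r < 1" "\<And>n. cmod (x n) \<le> r" "summable (\<lambda>n. cmod (\<alpha> n))"
  defines "T \<equiv> \<lambda>n \<theta>. \<alpha> n * aw_weight q a b c (x n) (cis \<theta>)"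
  shows "\<And>\<theta>. \<theta> \<in> {0..pi} \<Longrightarrow> summable (\<lambda>n. T n \<theta>)"
    and "(\<lambda>\<theta>. \<Sum>n. T n \<theta>) integrable_on {0..pi}"
    and "(\<lambda>n. \<alpha> n * aw_integral q a b c (x n)) sums integral {0..pi} (\<lambda>\<theta>. \<Sum>n. T n \<theta>)"
proof -
  have "continuous_on (cball 0 r \<times> {0..pi}) (\<lambda>p. aw_weight q a b c (fst p) (cis (snd p)))"
    using assms by (intro continuous_on_aw_weight continuous_intros) auto
  then have "compact ((\<lambda>p. aw_weight q a b c (fst p) (cis (snd p))) ` (cball 0 r \<times> {0..pi}))"
    by (intro compact_continuous_image compact_Times) auto
  then obtain M where M: "cmod (aw_weight q a b c d (cis \<theta>)) \<le> M" if "cmod d \<le> r" "\<theta> \<in> {0..pi}" for d \<theta>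
    by (force dest!: compact_imp_bounded simp: bounded_iff)
  have bound: "norm (T n \<theta>) \<le> cmod (\<alpha> n) * M" if "\<theta> \<in> {0..pi}" for n \<theta>
    using M[OF assms(6) that] by (simp add: T_def norm_mult mult_left_mono)
  have sM: "summable (\<lambda>n. cmod (\<alpha> n) * M)"
    using assms(7) by (rule summable_mult2)
  show "summable (\<lambda>n. T n \<theta>)" if "\<theta> \<in> {0..pi}" for \<theta>
    using bound[OF that] by (intro summable_comparison_test'[OF sM])
  have contT: "continuous_on {0..pi} (T n)" for n
    unfolding T_def using assms le_less_trans[OF assms(6) assms(5)]
    by (intro continuous_intros continuous_on_aw_weight) auto
  have "uniform_limit {0..pi} (\<lambda>n \<theta>. \<Sum>i<n. T i \<theta>) (\<lambda>\<theta>. \<Sum>i. T i \<theta>) sequentially"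
    using bound sM by (intro Weierstrass_m_test)
  moreover have "continuous_on {0..pi} (\<lambda>\<theta>. \<Sum>i<n. T i \<theta>)" for n
    by (intro continuous_on_sum contT)
  ultimately obtain I J where IJ: "\<And>n. ((\<lambda>\<theta>. \<Sum>i<n. T i \<theta>) has_integral I n) {0..pi}"
      "((\<lambda>\<theta>. \<Sum>i. T i \<theta>) has_integral J) {0..pi}" "I \<longlonglongrightarrow> J"
    using uniform_limit_integral[OF _ _ sequentially_bot] by metis
  have "I = (\<lambda>n. \<Sum>i<n. \<alpha> i * aw_integral q a b c (x i))"
  proof
    fix n
    have "I n = integral {0..pi} (\<lambda>\<theta>. \<Sum>i<n. T i \<theta>)"
      by (rule integral_unique[OF IJ(1), symmetric])
    also have "\<dots> = (\<Sum>i<n. integral {0..pi} (T i))"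
      by (intro Henstock_Kurzweil_Integration.integral_sum integrable_continuous_interval contT) auto
    finally show "I n = (\<Sum>i<n. \<alpha> i * aw_integral q a b c (x i))"
      by (simp add: T_def aw_integral_def)
  qed
  then show "(\<lambda>n. \<alpha> n * aw_integral q a b c (x n)) sums integral {0..pi} (\<lambda>\<theta>. \<Sum>n. T n \<theta>)"
    using IJ(3) by (simp add: sums_def integral_unique[OF IJ(2)])
  show "(\<lambda>\<theta>. \<Sum>n. T n \<theta>) integrable_on {0..pi}"
    using IJ(2) by (rule has_integral_integrable)
qed

text \<open>Ratio test: the quotients of consecutive terms tend to |q| L, which is at most |q| and
  so lies below any \<rho> strictly between |q| and 1.\<close>

lemma summable_q_ratio:
  assumes "cmod q < 1" "q_ratio_limit_le_1 q f x"
  shows "summable (\<lambda>n. cmod (q ^ n * f (x * q ^ n)))"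
proof -
  obtain L where L: "L \<le> 1" "(\<lambda>n. cmod (f (x * q ^ Suc n) / f (x * q ^ n))) \<longlonglongrightarrow> L"
    using assms(2) by (auto simp: q_ratio_limit_le_1_def)
  obtain \<rho> where \<rho>: "cmod q < \<rho>" "\<rho> < 1"
    using dense[OF assms(1)] by blast
  have "(\<lambda>n. cmod q * cmod (f (x * q ^ Suc n) / f (x * q ^ n))) \<longlonglongrightarrow> cmod q * L"
    by (intro tendsto_intros L)
  moreover have "cmod q * L < \<rho>"
    using mult_left_mono[OF L(1), of "cmod q"] \<rho> by simp
  ultimately have "\<forall>\<^sub>F n in sequentially. cmod q * cmod (f (x * q ^ Suc n) / f (x * q ^ n)) < \<rho>"
    by (rule order_tendstoD)
  \<comment> \<open>Where f vanishes the quotient has the default value 0 and bounds nothing;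
    nonvanishing allows the denominator to be cleared.\<close>
  moreover have "\<forall>\<^sub>F n in sequentially. f (x * q ^ n) \<noteq> 0"
    using assms(2) by (simp add: q_ratio_limit_le_1_def)
  ultimately have "\<forall>\<^sub>F n in sequentially.
      cmod (q ^ Suc n * f (x * q ^ Suc n)) \<le> \<rho> * cmod (q ^ n * f (x * q ^ n))"
  proof eventually_elim
    case (elim n)
    then have "cmod q * cmod (f (x * q ^ Suc n)) \<le> \<rho> * cmod (f (x * q ^ n))"
      by (simp add: norm_divide field_simps)
    from mult_left_mono[OF this, of "cmod q ^ n"] show ?case
      by (simp add: norm_mult norm_power mult_ac)
  qed
  then obtain N where "\<And>n. n \<ge> N \<Longrightarrow>
      cmod (q ^ Suc n * f (x * q ^ Suc n)) \<le> \<rho> * cmod (q ^ n * f (x * q ^ n))"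
    by (auto simp: eventually_sequentially)
  then show ?thesis
    using \<rho>(2) by (intro summable_ratio_test[of \<rho> N]) auto
qed

text \<open>The arguments of the Pochhammer symbols stay in a fixed disc along the orbit, so these
  are bounded and \<open>summable_q_ratio\<close> supplies the majorant.\<close>

lemma summable_jackson_coeff:
  assumes "cmod q < 1" "q_ratio_limit_le_1 q f x"
  shows "summable (\<lambda>n. cmod (x * (qpochs_inf q [q * (x * q ^ n) / u, q * (x * q ^ n) / v] * f (x * q ^ n)) * q ^ n))"
proof -
  have "\<exists>B. \<forall>n. cmod (qpoch_inf q (q * (x * q ^ n) / w)) \<le> B" for w
  proof -
    obtain B where B: "\<And>z. cmod z \<le> cmod (q * x / w) \<Longrightarrow> cmod (qpoch_inf q z) \<le> B"
      using qpoch_inf_bounded[OF assms(1)] by blast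
    have "cmod (q * (x * q ^ n) / w) \<le> cmod (q * x / w)" for n
    proof -
      have "cmod (q * x / w) * cmod q ^ n \<le> cmod (q * x / w) * 1"
        using assms(1) by (intro mult_left_mono power_le_one) auto
      then show ?thesis
        by (simp add: norm_mult norm_divide norm_power mult_ac)
    qed
    then show ?thesis
      using B by blast
  qed
  then obtain B C where B: "\<And>n. cmod (qpoch_inf q (q * (x * q ^ n) / u)) \<le> B"
      and C: "\<And>n. cmod (qpoch_inf q (q * (x * q ^ n) / v)) \<le> C"
    by metis
  have "cmod (x * (qpochs_inf q [q * (x * q ^ n) / u, q * (x * q ^ n) / v] * f (x * q ^ n)) * q ^ n) \<le>
      cmod x * B * C * cmod (q ^ n * f (x * q ^ n))" for n
  proof -
    have "cmod (qpoch_inf q (q * (x * q ^ n) / u)) * cmod (qpoch_inf q (q * (x * q ^ n) / v)) \<le> B * C"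
      using B[of n] C[of n] by (intro mult_mono) (auto intro: order_trans[OF norm_ge_zero])
    from mult_left_mono[OF this, of "cmod x * cmod (q ^ n * f (x * q ^ n))"] show ?thesis
      by (simp add: qpochs_inf_def norm_mult mult_ac)
  qed
  then show ?thesis
    by (intro summable_comparison_test'[OF summable_mult[OF summable_q_ratio[OF assms], of "cmod x * B * C"]]) auto
qed

section \<open>Reduction of the Jackson integral identity to the Askey-Wilson integral\<close>

theorem theorem5p4:
  fixes q a b c u v :: complex and f :: "complex \<Rightarrow> complex"
  assumes "cmod q < 1"
    and "Max {cmod a, cmod b, cmod c, cmod u, cmod v} < 1"
    and "u \<noteq> 0" and "v \<noteq> 0"
    and "q_ratio_limit_le_1 q f u" and "q_ratio_limit_le_1 q f v"
  shows
    "qpoch_inf q q / (2 * complex_of_real pi) *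
       integral {0..pi} (\<lambda>\<theta>.
         hs_fun q (complex_of_real (cos (2 * \<theta>))) [1] /
         hs_fun q (complex_of_real (cos \<theta>)) [a, b, c] *
         jackson_integral q u v (\<lambda>x.
           qpochs_inf q [q * x / u, q * x / v] * f x /
           qpochs_inf q [x * exp (\<i> * complex_of_real \<theta>), x * exp (- \<i> * complex_of_real \<theta>)])) =
     1 / qpochs_inf q [a * b, a * c, b * c] *
       jackson_integral q u v (\<lambda>x.
         qpochs_inf q [q * x / u, q * x / v, a * b * c * x] * f x /
         qpochs_inf q [a * x, b * x, c * x])"
proof -
  have abc: "cmod a < 1" "cmod b < 1" "cmod c < 1" and uv: "cmod u < 1" "cmod v < 1"
    using assms(2) by auto
  \<comment> \<open>The part of the n-th Jackson term at endpoint x that is independent of theta;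
    what remains joins the outer quotient to form the weight with d = x q^n.\<close>
  define \<kappa> where "\<kappa> = (\<lambda>x n. x * (qpochs_inf q [q * (x * q ^ n) / u, q * (x * q ^ n) / v] * f (x * q ^ n)) * q ^ n)"
  define K where "K = qpoch_inf q q / (2 * complex_of_real pi)"
  define D where "D = qpochs_inf q [a * b, a * c, b * c]"
  have D0: "D \<noteq> 0"
    using abc mult_strict_mono'[of "cmod a" 1 "cmod b" 1] mult_strict_mono'[of "cmod a" 1 "cmod c" 1]
      mult_strict_mono'[of "cmod b" 1 "cmod c" 1]
    by (simp add: D_def qpochs_inf_def qpoch_inf_nonzero[OF assms(1)] norm_mult)
  have orbit: "cmod (x * q ^ n) \<le> cmod x" for x n
  proof -
    have "cmod x * cmod q ^ n \<le> cmod x * 1"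
      using assms(1) by (intro mult_left_mono power_le_one) auto
    then show ?thesis
      by (simp add: norm_mult norm_power)
  qed
  define S where "S = (\<lambda>x \<theta>. \<Sum>n. \<kappa> x n * aw_weight q a b c (x * q ^ n) (cis \<theta>))"
  note sums = aw_integral_sums[OF assms(1) abc _ orbit, of _ "\<kappa> _"]
  have \<kappa>: "summable (\<lambda>n. cmod (\<kappa> u n))" "summable (\<lambda>n. cmod (\<kappa> v n))"
    unfolding \<kappa>_def by (intro summable_jackson_coeff assms)+
  have integrand: "hs_fun q (complex_of_real (cos (2 * \<theta>))) [1] /
         hs_fun q (complex_of_real (cos \<theta>)) [a, b, c] *
         jackson_integral q u v (\<lambda>x.
           qpochs_inf q [q * x / u, q * x / v] * f x /
           qpochs_inf q [x * exp (\<i> * complex_of_real \<theta>), x * exp (- \<i> * complex_of_real \<theta>)]) =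
      (1 - q) * (S v \<theta> - S u \<theta>)" if \<theta>: "\<theta> \<in> {0..pi}" for \<theta>
  proof -
    define k where "k = hs_fun q (complex_of_real (cos (2 * \<theta>))) [1] / hs_fun q (complex_of_real (cos \<theta>)) [a, b, c]"
    define g where "g = (\<lambda>x. qpochs_inf q [q * x / u, q * x / v] * f x /
           qpochs_inf q [x * exp (\<i> * complex_of_real \<theta>), x * exp (- \<i> * complex_of_real \<theta>)])"
    define t where "t = (\<lambda>n. (v * g (v * q ^ n) - u * g (u * q ^ n)) * q ^ n)"
    have k: "k = aw_factor q ((cis \<theta>)\<^sup>2) 1 / (aw_factor q (cis \<theta>) a * aw_factor q (cis \<theta>) b * aw_factor q (cis \<theta>) c)"
      by (simp add: k_def hs_fun_def h_fun_cos[OF assms(1)] aw_factor_def Complex.DeMoivre mult_ac)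
    have g: "g x = qpochs_inf q [q * x / u, q * x / v] * f x / aw_factor q (cis \<theta>) x" for x
      by (simp add: g_def qpochs_inf_def aw_factor_def cis_conv_exp exp_minus divide_inverse)
    have kt: "k * t n = \<kappa> v n * aw_weight q a b c (v * q ^ n) (cis \<theta>) - \<kappa> u n * aw_weight q a b c (u * q ^ n) (cis \<theta>)" for n
      unfolding t_def k g \<kappa>_def aw_weight_def
      by (simp add: left_diff_distrib right_diff_distrib mult_ac)
    have "(\<lambda>n. k * t n) sums (S v \<theta> - S u \<theta>)"
      unfolding kt S_def using sums(1)[OF uv(1) \<kappa>(1) \<theta>] sums(1)[OF uv(2) \<kappa>(2) \<theta>]
      by (intro sums_diff summable_sums)
    moreover have "(\<lambda>n. k * t n) sums (k * suminf t)"
    \<comment> \<open>At theta = 0 and pi the numerator h(cos 2 theta; 1) vanishes. Summability of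
      \<open>t\<close> cannot be read off from \<open>k * t n\<close> there, but both sides are
      zero.\<close>
    proof (cases "k = 0")
      case False
      then have "summable t"
        using calculation by (auto simp: sums_iff)
      then show ?thesis
        by (intro sums_mult summable_sums)
    qed simp
    ultimately have "k * suminf t = S v \<theta> - S u \<theta>"
      by (rule sums_unique2[symmetric])
    then show ?thesis
      unfolding k_def[symmetric] g_def[symmetric] jackson_integral_def
      by (simp add: mult.left_commute flip: t_def)
  qed
  have aw: "K * aw_integral q a b c x * D = qpoch_inf q (a * b * c * x) / qpochs_inf q [a * x, b * x, c * x]"
    if "cmod x < 1" for x
  proof -
    have "K * aw_integral q a b c x =
        qpoch_inf q (a * b * c * x) / (D * qpochs_inf q [a * x, b * x, c * x])"
      using askey_wilson_integral[OF assms(1) abc that]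
      by (simp add: K_def D_def qpochs_inf_def mult_ac)
    then show ?thesis
      using D0 by simp
  qed
  \<comment> \<open>The Askey-Wilson evaluation is read backwards at d = v q^n and d = u q^n,
    turning the right-hand Jackson sum into a series of integrals with the same coefficients
    \<kappa>.\<close>
  have "jackson_integral q u v (\<lambda>x.
         qpochs_inf q [q * x / u, q * x / v, a * b * c * x] * f x /
         qpochs_inf q [a * x, b * x, c * x]) =
      (1 - q) * (\<Sum>n. K * D * (\<kappa> v n * aw_integral q a b c (v * q ^ n) - \<kappa> u n * aw_integral q a b c (u * q ^ n)))"
    (is "jackson_integral q u v ?g = _")
  proof -
    have "(v * ?g (v * q ^ n) - u * ?g (u * q ^ n)) * q ^ n =
        K * D * (\<kappa> v n * aw_integral q a b c (v * q ^ n) - \<kappa> u n * aw_integral q a b c (u * q ^ n))" for n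
    proof -
      have "?g x = (qpochs_inf q [q * x / u, q * x / v] * f x) * (K * aw_integral q a b c x * D)" if "cmod x < 1" for x
        unfolding aw[OF that] by (simp add: qpochs_inf_def mult_ac)
      note this[OF le_less_trans[OF orbit uv(1)]] this[OF le_less_trans[OF orbit uv(2)]]
      note * = this[of n]
      show ?thesis
        unfolding * \<kappa>_def by (simp add: left_diff_distrib right_diff_distrib mult_ac)
    qed
    then show ?thesis
      by (simp only: jackson_integral_def)
  qed
  also have "(\<Sum>n. K * D * (\<kappa> v n * aw_integral q a b c (v * q ^ n) - \<kappa> u n * aw_integral q a b c (u * q ^ n))) =
      K * D * (integral {0..pi} (S v) - integral {0..pi} (S u))"
    unfolding S_def by (intro sums_unique[symmetric] sums_mult sums_diff sums(3) uv \<kappa>)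
  also have "integral {0..pi} (S v) - integral {0..pi} (S u) = integral {0..pi} (\<lambda>\<theta>. S v \<theta> - S u \<theta>)"
    unfolding S_def
    by (intro Henstock_Kurzweil_Integration.integral_diff[symmetric] sums(2) uv \<kappa>)
  finally have rhs: "1 / D * jackson_integral q u v ?g = K * integral {0..pi} (\<lambda>\<theta>. (1 - q) * (S v \<theta> - S u \<theta>))"
    using D0 by simp
  show ?thesis
    unfolding K_def[symmetric] D_def[symmetric] rhs
    by (intro arg_cong[where f = "times K"] Henstock_Kurzweil_Integration.integral_cong integrand)
qed

end
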